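(* Let $x\in(0,1)$ be irrational, let $x=[0;a_1/b_1,a_2/b_2,\ldots]$ be any proper continued fraction expansion of $x$, and let $p_n,q_n$ be the associated (unreduced) numerators and denominators. Then for every $n\geq 1$, $$\left|x-\frac{p_n}{q_n}\right|<\frac{x}{q_n},\qquad\text{i.e.}\qquad |q_nx-p_n|<x.$$
   Context: A proper continued fraction (PCF) expansion of an irrational $x\in(0,1)$ consists of sequences of positive integers $(a_n)_{n\ge1}$, $(b_n)_{n\ge1}$ with $b_n\ge a_n$ for all $n$ such that $$x=\cfrac{a_1}{b_1+\cfrac{a_2}{b_2+\ddots}},$$ written $x=[0;a_1/b_1,a_2/b_2,\ldots]$, meaning $x=\lim_{n\to\infty}p_n/q_n$, where $p_{-1}=1,\ p_0=0,\ q_{-1}=0,\ q_0=1$ and $p_n=b_np_{n-1}+a_np_{n-2}$, $q_n=b_nq_{n-1}+a_nq_{n-2}$ for $n\ge1$. For a given sequence of numerators $(a_n)$ the expansion of $x$ is unique and is produced by $x_0=x$, $b_n=\lfloor a_n/x_{n-1}\rfloor$, $x_n=a_n/x_{n-1}-b_n$. The integers $p_n,q_n$ are always those given by the recurrences; common factors are not cancelled. *)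

theory Defs
  imports Complex_Main
begin

(* The sequences a and b are indexed from 1; the values a 0 and b 0 are never used.
   The n-th values of pcf_p and pcf_q are p_n and q_n for n = 0, 1, 2, ...; common
   factors are not cancelled.
   The initial values p_{-1} = 1 and q_{-1} = 0 enter only through the clause for n = 1. *)

fun pcf_p :: "(nat \<Rightarrow> nat) \<Rightarrow> (nat \<Rightarrow> nat) \<Rightarrow> nat \<Rightarrow> nat" where
  "pcf_p a b 0 = 0"
| "pcf_p a b (Suc 0) = b 1 * pcf_p a b 0 + a 1 * 1"
| "pcf_p a b (Suc (Suc n)) =
     b (Suc (Suc n)) * pcf_p a b (Suc n) + a (Suc (Suc n)) * pcf_p a b n"

fun pcf_q :: "(nat \<Rightarrow> nat) \<Rightarrow> (nat \<Rightarrow> nat) \<Rightarrow> nat \<Rightarrow> nat" where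
  "pcf_q a b 0 = 1"
| "pcf_q a b (Suc 0) = b 1 * pcf_q a b 0 + a 1 * 0"
| "pcf_q a b (Suc (Suc n)) =
     b (Suc (Suc n)) * pcf_q a b (Suc n) + a (Suc (Suc n)) * pcf_q a b n"

definition pcf_expansion :: "real \<Rightarrow> (nat \<Rightarrow> nat) \<Rightarrow> (nat \<Rightarrow> nat) \<Rightarrow> bool" where
  "pcf_expansion x a b \<longleftrightarrow>
     (\<forall>n\<ge>1. 0 < a n \<and> 0 < b n \<and> a n \<le> b n) \<and>
     (\<lambda>n. real (pcf_p a b n) / real (pcf_q a b n)) \<longlonglongrightarrow> x"

end

theory Submission
  imports Defs
begin

text \<open>The convergents lie alternately below and above \<open>x\<close>, strictly since \<open>x\<close> is irrational, so
  \<open>E n = (-1)^n (q\<^sub>n x - p\<^sub>n)\<close> is positive. The recurrences for \<open>p\<close> and \<open>q\<close> give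
  \<open>b\<^bsub>n+2\<^esub> E (n+1) + E (n+2) = a\<^bsub>n+2\<^esub> E n \<le> b\<^bsub>n+2\<^esub> E n\<close>, hence \<open>E\<close> is strictly decreasing, and
  \<open>E 0 = x\<close>.\<close>

lemma pcf_q_pos:
  assumes "\<And>n. n \<ge> 1 \<Longrightarrow> 0 < b n"
  shows "0 < pcf_q a b n"
proof -
  \<comment> \<open>Two consecutive values are carried along because the recurrence reaches back two
    indices.\<close>
  have "0 < pcf_q a b n \<and> 0 < pcf_q a b (Suc n)"
    by (induction n) (use assms in auto)
  then show ?thesis ..
qed

text \<open>Up to the positive factor \<open>q_m q_n\<close>, this is the difference of the
  convergents \<open>m\<close> and \<open>n\<close>, signed so that a nonnegative value puts
  convergent \<open>m\<close> on the side of convergent \<open>n\<close> where \<open>x\<close> is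
  expected.\<close>

definition pcf_det :: "(nat \<Rightarrow> nat) \<Rightarrow> (nat \<Rightarrow> nat) \<Rightarrow> nat \<Rightarrow> nat \<Rightarrow> real" where
  "pcf_det a b n m = (- 1) ^ n *
     (real (pcf_p a b m) * real (pcf_q a b n) - real (pcf_p a b n) * real (pcf_q a b m))"

lemma pcf_det_rec:
  "pcf_det a b n (Suc (Suc m)) =
     real (b (Suc (Suc m))) * pcf_det a b n (Suc m) + real (a (Suc (Suc m))) * pcf_det a b n m"
  by (simp add: pcf_det_def algebra_simps)

text \<open>Expanding \<open>p\<close> and \<open>q\<close> at the larger index cancels the
  \<open>b\<close> terms, and the sign \<open>(-1)^n\<close> absorbs the swap of rows; the value is
  thus the product of \<open>a 1\<close> to \<open>a (Suc n)\<close>.\<close>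

lemma pcf_det_Suc_pos:
  assumes "\<And>n. n \<ge> 1 \<Longrightarrow> 0 < a n"
  shows "0 < pcf_det a b n (Suc n)"
proof (induction n)
  case 0
  show ?case using assms[of 1] by (simp add: pcf_det_def)
next
  case (Suc n)
  have "pcf_det a b (Suc n) (Suc (Suc n)) = real (a (Suc (Suc n))) * pcf_det a b n (Suc n)"
    by (simp add: pcf_det_def algebra_simps)
  then show ?case using Suc assms by simp
qed

text \<open>For fixed \<open>n\<close> the recurrence in \<open>m\<close> has nonnegative
  coefficients and starts from 0 at \<open>m = n\<close> and a positive value at
  \<open>m = Suc n\<close>. So all later convergents stay on one side of the
  \<open>n\<close>-th.\<close>

lemma pcf_det_nonneg:
  assumes a: "\<And>n. n \<ge> 1 \<Longrightarrow> 0 < a n"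
    and "n \<le> m"
  shows "0 \<le> pcf_det a b n m"
proof -
  have "0 \<le> pcf_det a b n (n + k) \<and> 0 \<le> pcf_det a b n (Suc (n + k))" for k
  proof (induction k)
    case 0
    show ?case using pcf_det_Suc_pos[where a = a and b = b and n = n, OF a] by (simp add: pcf_det_def)
  next
    case (Suc k)
    then show ?case by (simp add: pcf_det_rec)
  qed
  then show ?thesis using le_Suc_ex[OF \<open>n \<le> m\<close>] by blast
qed

definition pcf_err :: "real \<Rightarrow> (nat \<Rightarrow> nat) \<Rightarrow> (nat \<Rightarrow> nat) \<Rightarrow> nat \<Rightarrow> real" where
  "pcf_err x a b n = (- 1) ^ n * (real (pcf_q a b n) * x - real (pcf_p a b n))"

lemma pcf_err_rec:
  "real (b (Suc (Suc n))) * pcf_err x a b (Suc n) + pcf_err x a b (Suc (Suc n)) =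
     real (a (Suc (Suc n))) * pcf_err x a b n"
  by (simp add: pcf_err_def algebra_simps)

lemma pcf_err_pos:
  assumes "pcf_expansion x a b" and "x \<notin> \<rat>"
  shows "0 < pcf_err x a b n"
proof -
  have a: "0 < a n" and b: "0 < b n" if "n \<ge> 1" for n
    using assms that by (auto simp: pcf_expansion_def)
  have q: "0 < pcf_q a b m" for m
    using b by (rule pcf_q_pos)
  have lim: "(\<lambda>m. real (pcf_p a b m) / real (pcf_q a b m)) \<longlonglongrightarrow> x"
    using assms by (simp add: pcf_expansion_def)
  \<comment> \<open>\<open>pcf_err\<close> is affine in its first argument, so its sign at
    \<open>x\<close> can be obtained as a limit of its values at the convergents.\<close>
  have "(\<lambda>m. pcf_err (real (pcf_p a b m) / real (pcf_q a b m)) a b n) \<longlonglongrightarrow> pcf_err x a b n"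
    unfolding pcf_err_def by (intro tendsto_intros lim)
  moreover have "0 \<le> pcf_err (real (pcf_p a b m) / real (pcf_q a b m)) a b n" if "n \<le> m" for m
  proof -
    have "pcf_err (real (pcf_p a b m) / real (pcf_q a b m)) a b n =
        pcf_det a b n m / real (pcf_q a b m)"
      using q[of m] by (simp add: pcf_err_def pcf_det_def field_simps)
    then show ?thesis using pcf_det_nonneg[OF a that] by simp
  qed
  ultimately have "0 \<le> pcf_err x a b n"
    by (intro LIMSEQ_le_const) auto
  moreover have "pcf_err x a b n \<noteq> 0"
  proof
    assume "pcf_err x a b n = 0"
    then have "x = real (pcf_p a b n) / real (pcf_q a b n)"
      using q[of n] by (simp add: pcf_err_def field_simps)
    then show False using \<open>x \<notin> \<rat>\<close> by simp
  qed
  ultimately show ?thesis by simp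
qed

lemma pcf_err_Suc_less:
  assumes "pcf_expansion x a b" and "x \<notin> \<rat>"
  shows "pcf_err x a b (Suc n) < pcf_err x a b n"
proof -
  let ?m = "Suc (Suc n)"
  have b: "0 < b ?m" "a ?m \<le> b ?m"
    using assms by (auto simp: pcf_expansion_def)
  have "real (b ?m) * pcf_err x a b (Suc n) < real (a ?m) * pcf_err x a b n"
    using pcf_err_rec[of b n x a] pcf_err_pos[OF assms, of ?m] by linarith
  \<comment> \<open>Properness of the expansion enters here, as
    \<open>a ?m \<le> b ?m\<close>.\<close>
  also have "\<dots> \<le> real (b ?m) * pcf_err x a b n"
    using b pcf_err_pos[OF assms, of n] by (intro mult_right_mono) auto
  finally show ?thesis using b by simp
qed

theorem theorem3p1:
  fixes x :: real and a b :: "nat \<Rightarrow> nat" and n :: nat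
  assumes "0 < x" and "x < 1" and "x \<notin> \<rat>"
    and "pcf_expansion x a b"
    and "n \<ge> 1"
  shows "\<bar>x - real (pcf_p a b n) / real (pcf_q a b n)\<bar> < x / real (pcf_q a b n)
       \<and> \<bar>real (pcf_q a b n) * x - real (pcf_p a b n)\<bar> < x"
proof -
  let ?p = "real (pcf_p a b n)" and ?q = "real (pcf_q a b n)"
  have q: "0 < ?q"
    using pcf_q_pos[of b a n] assms(4) by (auto simp: pcf_expansion_def)
  have "\<bar>?q * x - ?p\<bar> = \<bar>pcf_err x a b n\<bar>"
    by (simp add: pcf_err_def abs_mult power_abs)
  also have "\<dots> = pcf_err x a b n"
    using pcf_err_pos[OF assms(4,3), of n] by simp
  also have "\<dots> < pcf_err x a b 0"
    \<comment> \<open>The library lemma treats increasing sequences, hence the negation.\<close>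
    using lift_Suc_mono_less[of "\<lambda>n. - pcf_err x a b n" 0 n]
      pcf_err_Suc_less[OF assms(4,3)] \<open>n \<ge> 1\<close> by simp
  also have "\<dots> = x"
    by (simp add: pcf_err_def)
  finally have less: "\<bar>?q * x - ?p\<bar> < x" .
  have "\<bar>x - ?p / ?q\<bar> = \<bar>(?q * x - ?p) / ?q\<bar>"
    using q by (simp add: diff_divide_distrib)
  also have "\<dots> = \<bar>?q * x - ?p\<bar> / ?q"
    using q by (simp only: abs_divide abs_of_pos)
  also have "\<dots> < x / ?q"
    using less q by (rule divide_strict_right_mono)
  finally show ?thesis using less by simp
qed

end
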